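(* Let $S$ be an étale semicategory. Then the product map $S^2\to S$, $(a,b)\mapsto ab$, is an open map (where $S^2$ carries the subspace topology from $S\times S$).
   Context: **Semicategories.** A semigroupoid is a set $S$ with a product defined on some pairs $S^2\subseteq S\times S$ such that $(ab)c$ is defined iff $a(bc)$ is defined, in which case they are equal. Its units are $S^0=\{u\in S:\forall a\in S\ [(u,a)\in S^2\Rightarrow ua=a]\text{ and }[(a,u)\in S^2\Rightarrow au=a]\}$. The source unit $\mathsf s(a)$ of $a$ is the (unique, if it exists) $u\in S^0$ with $(a,u)\in S^2$; the range unit $\mathsf r(a)$ is the (unique, if it exists) $u\in S^0$ with $(u,a)\in S^2$. $S$ is a semicategory if every $a\in S$ has a source unit and $S^2=\{(a,b):\mathsf r(b)\text{ exists and }\mathsf s(a)=\mathsf r(b)\}$. $S^0S$ denotes the set of elements having a range unit. **Étale.** A semicategory with a topology is topological if $\mathsf s$ (on $S$), $\mathsf r$ (on $S^0S$) and the product (on $S^2$) are continuous. It is étale if it is topological, $S^0S$ is open in $S$ and $\mathsf s:S\to S$ is a locally injective open map. *)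

theory Defs
  imports "HOL-Analysis.Analysis"
begin

text \<open>
  The partial product on \<open>S\<close> is given by its domain \<open>D\<close> (written \<open>S\<^sup>2\<close> in the literature) and a
  function whose values outside \<open>D\<close> are irrelevant.
\<close>

locale semigroupoid =
  fixes S :: "'a set" and D :: "('a \<times> 'a) set" and mult :: "'a \<Rightarrow> 'a \<Rightarrow> 'a" (infixl \<open>\<cdot>\<close> 70)
  assumes dom_subset: "D \<subseteq> S \<times> S"
    and mult_closed: "(a, b) \<in> D \<Longrightarrow> a \<cdot> b \<in> S"
    and assoc_dom: "\<lbrakk>a \<in> S; b \<in> S; c \<in> S\<rbrakk> \<Longrightarrow>
      (a, b) \<in> D \<and> (a \<cdot> b, c) \<in> D \<longleftrightarrow> (b, c) \<in> D \<and> (a, b \<cdot> c) \<in> D"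
    and assoc: "\<lbrakk>(a, b) \<in> D; (a \<cdot> b, c) \<in> D\<rbrakk> \<Longrightarrow> (a \<cdot> b) \<cdot> c = a \<cdot> (b \<cdot> c)"
begin

definition units :: "'a set" where
  "units = {u \<in> S. \<forall>a\<in>S. ((u, a) \<in> D \<longrightarrow> u \<cdot> a = a) \<and> ((a, u) \<in> D \<longrightarrow> a \<cdot> u = a)}"

definition is_source :: "'a \<Rightarrow> 'a \<Rightarrow> bool" where
  "is_source a u \<longleftrightarrow> u \<in> units \<and> (a, u) \<in> D"

definition is_range :: "'a \<Rightarrow> 'a \<Rightarrow> bool" where
  "is_range a u \<longleftrightarrow> u \<in> units \<and> (u, a) \<in> D"

lemma is_source_unique:
  assumes "is_source a u" "is_source a v"
  shows "u = v"
proof -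
  have S: "a \<in> S" "u \<in> S" "v \<in> S"
    using assms dom_subset by (auto simp: is_source_def)
  have "a \<cdot> u = a"
    using assms S by (auto simp: is_source_def units_def)
  then have "(u, v) \<in> D"
    using assoc_dom[OF S] assms by (auto simp: is_source_def)
  then show ?thesis
    using assms S by (auto simp: is_source_def units_def)
qed

lemma is_range_unique:
  assumes "is_range a u" "is_range a v"
  shows "u = v"
proof -
  have S: "u \<in> S" "v \<in> S" "a \<in> S"
    using assms dom_subset by (auto simp: is_range_def)
  have "v \<cdot> a = a"
    using assms S by (auto simp: is_range_def units_def)
  then have "(u, v) \<in> D"
    using assoc_dom[OF S] assms by (auto simp: is_range_def)
  then show ?thesis
    using assms S by (auto simp: is_range_def units_def)
qed

definition source :: "'a \<Rightarrow> 'a" where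
  "source a = (THE u. is_source a u)"

definition range_unit :: "'a \<Rightarrow> 'a" where
  "range_unit a = (THE u. is_range a u)"

text \<open>The set written \<open>S\<^sup>0S\<close>, on which \<^term>\<open>range_unit\<close> is meaningful.\<close>

definition ranged :: "'a set" where
  "ranged = {a \<in> S. \<exists>u. is_range a u}"

end

locale semicategory = semigroupoid +
  assumes has_source: "a \<in> S \<Longrightarrow> \<exists>u. is_source a u"
    and dom_eq: "D = {(a, b). a \<in> S \<and> b \<in> ranged \<and> source a = range_unit b}"

locale topological_semicategory = semicategory S D mult
  for S :: "'a set" and D and mult (infixl \<open>\<cdot>\<close> 70) +
  fixes T :: "'a topology"
  assumes topspace_eq: "topspace T = S"
    and continuous_source: "continuous_map T T source"
    and continuous_range: "continuous_map (subtopology T ranged) T range_unit"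
    and continuous_mult:
      "continuous_map (subtopology (prod_topology T T) D) T (\<lambda>(a, b). a \<cdot> b)"

locale etale_semicategory = topological_semicategory +
  assumes open_ranged: "openin T ranged"
    and source_locally_injective: "a \<in> S \<Longrightarrow> \<exists>U. openin T U \<and> a \<in> U \<and> inj_on source U"
    and source_open: "open_map T T source"

end

theory Submission
  imports Defs
begin

text \<open>
  Let \<open>W\<close> be a neighbourhood of \<open>(a, b)\<close> in \<open>D\<close>, and let \<open>O\<close> be a neighbourhood of \<open>a \<cdot> b\<close> on which the
  source map is injective. An element \<open>c \<in> O\<close> close to \<open>a \<cdot> b\<close> has a source close to that of \<open>b\<close>.
  As the source map is open, that source is the source of some \<open>b'\<close> close to \<open>b\<close>, and in turn the
  range of \<open>b'\<close> is the source of some \<open>a'\<close> close to \<open>a\<close>. Then \<open>a' \<cdot> b'\<close> lies in \<open>O\<close> and has the same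
  source as \<open>c\<close>, so \<open>c = a' \<cdot> b'\<close>.
\<close>

lemma (in semigroupoid) source_eqI: "is_source a u \<Longrightarrow> source a = u"
  unfolding source_def by (blast intro: is_source_unique)

text \<open>If \<open>u\<close> is the source of \<open>b\<close>, then
  \<open>b \<cdot> u = b\<close>, so \<open>assoc_dom\<close> turns composability of
  \<open>a\<close> with \<open>b \<cdot> u\<close> into that of \<open>a \<cdot> b\<close> with
  \<open>u\<close>.\<close>

lemma (in semicategory) source_mult:
  assumes ab: "(a, b) \<in> D"
  shows "source (a \<cdot> b) = source b"
proof -
  have S: "a \<in> S" "b \<in> S"
    using ab dom_subset by auto
  obtain u where u: "is_source b u"
    using has_source S by blast
  then have "u \<in> S" "(b, u) \<in> D" "b \<cdot> u = b"
    using S by (auto simp: is_source_def units_def)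
  then have "is_source (a \<cdot> b) u"
    using assoc_dom[OF S] ab u by (auto simp: is_source_def)
  then show ?thesis
    using u by (simp add: source_eqI)
qed

text \<open>Rewriting with \<open>dom_eq\<close> itself would loop, since \<open>ranged\<close>,
  \<open>source\<close> and \<open>range_unit\<close> depend on \<open>D\<close>; this pointwise
  form is safe.\<close>

lemma (in semicategory) mem_dom_iff:
  "(a, b) \<in> D \<longleftrightarrow> a \<in> S \<and> b \<in> ranged \<and> source a = range_unit b"
proof -
  have "(a, b) \<in> D \<longleftrightarrow> (a, b) \<in> {(a, b). a \<in> S \<and> b \<in> ranged \<and> source a = range_unit b}"
    by (rule arg_cong[OF dom_eq])
  then show ?thesis
    by simp
qed

context etale_semicategory
begin

lemma mult_image_neighbourhood:
  assumes W: "openin (subtopology (prod_topology T T) D) W" and ab: "(a, b) \<in> W"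
  shows "\<exists>N. openin T N \<and> a \<cdot> b \<in> N \<and> N \<subseteq> (\<lambda>(a, b). a \<cdot> b) ` W"
proof -
  let ?X = "subtopology (prod_topology T T) D"
  have topspace_X: "topspace ?X = D"
    using dom_subset by (auto simp: topspace_eq)
  then have abD: "(a, b) \<in> D"
    using openin_subset[OF W] ab by auto
  obtain O' where O': "openin T O'" "a \<cdot> b \<in> O'" "inj_on source O'"
    using source_locally_injective mult_closed[OF abD] by blast
  have "openin ?X {x \<in> topspace ?X. (case x of (a, b) \<Rightarrow> a \<cdot> b) \<in> O'}"
    using continuous_mult O'(1) by (rule openin_continuous_map_preimage)
  \<comment> \<open>Shrinking \<open>W\<close> forces the products \<open>x \<cdot> y\<close> built
    below into \<open>O'\<close>, where sources separate points.\<close>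
  then have "openin ?X (W \<inter> {x \<in> D. (case x of (a, b) \<Rightarrow> a \<cdot> b) \<in> O'})"
    unfolding topspace_X using W by blast
  then obtain V where V: "openin (prod_topology T T) V"
    and V_eq: "W \<inter> {x \<in> D. (case x of (a, b) \<Rightarrow> a \<cdot> b) \<in> O'} = V \<inter> D"
    by (auto simp: openin_subtopology)
  have V_iff: "(x, y) \<in> W \<and> x \<cdot> y \<in> O' \<longleftrightarrow> (x, y) \<in> V" if "(x, y) \<in> D" for x y
    using arg_cong[OF V_eq, of "\<lambda>X. (x, y) \<in> X"] that by simp
  have "(a, b) \<in> V"
    using V_iff[OF abD] ab O'(2) by blast
  then obtain A B where AB: "openin T A" "openin T B" "a \<in> A" "b \<in> B" "A \<times> B \<subseteq> V"
    using V[unfolded openin_prod_topology_alt, rule_format, of a b] by auto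
  \<comment> \<open>The elements of \<open>B\<close> that have a composable left partner in
    \<open>A\<close>.\<close>
  define B' where "B' = B \<inter> {y \<in> ranged. range_unit y \<in> source ` A}"
  have "openin T (source ` A)"
    using source_open AB(1) by (auto simp: open_map_def)
  with continuous_range
  have "openin (subtopology T ranged)
      {y \<in> topspace (subtopology T ranged). range_unit y \<in> source ` A}"
    by (rule openin_continuous_map_preimage)
  moreover have "topspace (subtopology T ranged) = ranged"
    using openin_subset[OF open_ranged] by auto
  \<comment> \<open>Relative openness in \<open>ranged\<close> is openness in \<open>T\<close>
    because \<open>ranged\<close> is itself open.\<close>
  ultimately have "openin T {y \<in> ranged. range_unit y \<in> source ` A}"
    using open_ranged by (simp add: openin_open_subtopology del: topspace_subtopology)
  then have "openin T (source ` B')"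
    using source_open AB(2) unfolding B'_def open_map_def by blast
  then have "openin T {c \<in> topspace T. source c \<in> source ` B'}"
    by (rule openin_continuous_map_preimage[OF continuous_source])
  \<comment> \<open>This set serves as the neighbourhood \<open>N\<close>.\<close>
  then have "openin T (O' \<inter> {c \<in> S. source c \<in> source ` B'})"
    using O'(1) topspace_eq by auto
  moreover have "b \<in> B'"
    using abD AB(3,4) by (auto simp: B'_def mem_dom_iff intro: rev_image_eqI)
  then have "a \<cdot> b \<in> O' \<inter> {c \<in> S. source c \<in> source ` B'}"
    using O'(2) abD by (simp add: mult_closed source_mult)
  moreover have "O' \<inter> {c \<in> S. source c \<in> source ` B'} \<subseteq> (\<lambda>(a, b). a \<cdot> b) ` W"
  proof
    fix c assume "c \<in> O' \<inter> {c \<in> S. source c \<in> source ` B'}"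
    then obtain y where c: "c \<in> O'" and y: "y \<in> B'" "source c = source y"
      by auto
    then obtain x where x: "x \<in> A" "range_unit y = source x"
      by (auto simp: B'_def)
    have "x \<in> S"
      using x(1) openin_subset[OF AB(1)] topspace_eq by auto
    then have D: "(x, y) \<in> D"
      using x(2) y(1) by (simp add: B'_def mem_dom_iff)
    then have xy: "(x, y) \<in> W" "x \<cdot> y \<in> O'"
      using V_iff[OF D] AB(5) x(1) y(1) by (auto simp: B'_def)
    have "x \<cdot> y = c"
      using O'(3) xy(2) c y(2) source_mult[OF D] by (simp add: inj_on_def)
    then show "c \<in> (\<lambda>(a, b). a \<cdot> b) ` W"
      using xy(1) by force
  qed
  ultimately show ?thesis
    by blast
qed

lemma open_map_mult: "open_map (subtopology (prod_topology T T) D) T (\<lambda>(a, b). a \<cdot> b)"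
  unfolding open_map_def
proof (intro allI impI)
  fix W assume W: "openin (subtopology (prod_topology T T) D) W"
  show "openin T ((\<lambda>(a, b). a \<cdot> b) ` W)"
    by (subst openin_subopen) (use mult_image_neighbourhood[OF W] in fastforce)
qed

end

theorem proposition4p5:
  fixes S :: "'a set" and D :: "('a \<times> 'a) set"
    and mult :: "'a \<Rightarrow> 'a \<Rightarrow> 'a" and T :: "'a topology"
  assumes "etale_semicategory S D mult T"
  shows "open_map (subtopology (prod_topology T T) D) T (\<lambda>(a, b). mult a b)"
  using assms by (rule etale_semicategory.open_map_mult)

end
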